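(* Assume $\tau\le 1/(4L_f)$ and $f\in C^2$. Let $v_{\mathbf 2}^n,\bar v_{\mathbf 2}^n$ be the BDF2 solution and its perturbed solution, let $v_{\mathbf 4'}^n,\bar v_{\mathbf 4'}^n$ be the BDF2-DC4 solution and its perturbed solution with perturbations $\varepsilon_{\mathbf 4'}^n$, and let $\tilde v_{\mathbf 4'}^n:=\bar v_{\mathbf 4'}^n-v_{\mathbf 4'}^n$, so that for $3\le n\le N$ $$D_2\tilde v_{\mathbf 4'}^{n}=f(t_n,\bar v_{\mathbf 4'}^n)-f(t_n,v_{\mathbf 4'}^n)+\mathcal D_{2,4}f(t_n,v_{\mathbf 2}^n)-\mathcal D_{2,4}f(t_n,\bar v_{\mathbf 2}^n)+\varepsilon_{\mathbf 4'}^n.$$ Then for $3\le n\le N$ $$|\tilde v_{\mathbf 4'}^{n}|\le 4\exp(4L_ft_{n-1})\Big(|\tilde v_{\mathbf 4'}^{2}|+\tau|\partial_\tau\tilde v_{\mathbf 4'}^2|+t_n\max_{3\le i\le n}\Big\{|\varepsilon_{\mathbf 4'}^i|+\big|\mathcal D_{2,4}f(t_i,v_{\mathbf 2}^i)-\mathcal D_{2,4}f(t_i,\bar v_{\mathbf 2}^i)\big|\Big\}\Big).$$ Thus the BDF2-DC4 scheme is mesh-robustly stable, i.e. this stability estimate holds with a prefactor independent of the step ratios $r_n$.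
   Context: Problem: $v'(t)=f(t,v)$ for $0<t\le T$, $v(0)=v_0$, where $f$ is Lipschitz-continuous in $v$ with Lipschitz constant $L_f>0$. Mesh: $0=t_0<t_1<\cdots<t_N=T$ is an arbitrary mesh, $\tau_k:=t_k-t_{k-1}$ for $1\le k\le N$, $\tau:=\max_{1\le k\le N}\tau_k$, $r_k:=\tau_k/\tau_{k-1}$ for $k\ge2$. For a sequence $(w^n)$ put $\partial_\tau w^n:=(w^n-w^{n-1})/\tau_n$. BDF2 operator: $D_2w^n:=\sum_{j=1}^n d^{(n)}_{n-j}\partial_\tau w^j$ for $n\ge2$, with $d^{(n)}_0:=\frac{1+2r_n}{1+r_n}$, $d^{(n)}_1:=-\frac{r_n}{1+r_n}$, $d^{(n)}_j:=0$ for $j\ge2$. Corrections, with $f[\cdot,\ldots,\cdot]$ the Newton divided differences of the data $f(t_k,w^k)$ at $t_k$: $\mathcal D_{2,3}f(t_n,w^n):=\frac13\big[r_n(\tau_n+\tau_{n-1})^2-(1+r_n)\tau_n^2\big]f[t_n,t_{n-1},t_{n-2}]$ for $n\ge2$ (equivalently $\frac{\tau_n}{3}(\partial_\tau f(t_n,w^n)-\partial_\tau f(t_{n-1},w^{n-1}))$), and $\mathcal D_{2,4}f(t_n,w^n):=\mathcal D_{2,3}f(t_n,w^n)+\frac{\tau_n}{12}(\tau_n+\tau_{n-1})(2\tau_n+\tau_{n-1})f[t_n,t_{n-1},t_{n-2},t_{n-3}]$ for $n\ge3$. Schemes (starting values given): BDF2: $D_2v_{\mathbf 2}^n=f(t_n,v_{\mathbf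 2}^n)$ for $n\ge2$ (starting values at $t_0,t_1$); BDF2-DC4: $D_2v_{\mathbf 4'}^n+\mathcal D_{2,4}f(t_n,v_{\mathbf 2}^n)=f(t_n,v_{\mathbf 4'}^n)$ for $n\ge3$ (starting values at $t_0,t_1,t_2$). Perturbed schemes: $D_2\bar v_{\mathbf 2}^n=f(t_n,\bar v_{\mathbf 2}^n)+\varepsilon_{\mathbf 2}^n$ for $n\ge2$ and $D_2\bar v_{\mathbf 4'}^n+\mathcal D_{2,4}f(t_n,\bar v_{\mathbf 2}^n)=f(t_n,\bar v_{\mathbf 4'}^n)+\varepsilon_{\mathbf 4'}^n$ for $n\ge3$, with bounded sequences $\{\varepsilon_{\mathbf 2}^n\},\{\varepsilon_{\mathbf 4'}^n\}$. A stability estimate is called mesh-robust if its prefactor (constant) is independent of the step ratios $r_n$. *)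

theory Defs
  imports "HOL-Analysis.Analysis"
begin

text \<open>
  Grid functions are total functions on \<open>nat\<close>; for a mesh with \<open>N\<close> steps only the
  indices \<open>0..N\<close> are meaningful.
\<close>

definition is_mesh :: "real \<Rightarrow> nat \<Rightarrow> (nat \<Rightarrow> real) \<Rightarrow> bool" where
  "is_mesh T N t \<longleftrightarrow> t 0 = 0 \<and> (\<forall>k<N. t k < t (Suc k)) \<and> t N = T"

text \<open>Used for \<open>k \<ge> 1\<close> only; the step ratio below for \<open>k \<ge> 2\<close> only.\<close>

definition step :: "(nat \<Rightarrow> real) \<Rightarrow> nat \<Rightarrow> real" where
  "step t k = t k - t (k - 1)"

definition max_step :: "nat \<Rightarrow> (nat \<Rightarrow> real) \<Rightarrow> real" where
  "max_step N t = Max (step t ` {1..N})"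

definition step_ratio :: "(nat \<Rightarrow> real) \<Rightarrow> nat \<Rightarrow> real" where
  "step_ratio t k = step t k / step t (k - 1)"

definition diff_quot :: "(nat \<Rightarrow> real) \<Rightarrow> (nat \<Rightarrow> real) \<Rightarrow> nat \<Rightarrow> real" where
  "diff_quot t w n = (w n - w (n - 1)) / step t n"

definition bdf2_kernel :: "(nat \<Rightarrow> real) \<Rightarrow> nat \<Rightarrow> nat \<Rightarrow> real" where
  "bdf2_kernel t n j =
     (if j = 0 then (1 + 2 * step_ratio t n) / (1 + step_ratio t n)
      else if j = 1 then - (step_ratio t n / (1 + step_ratio t n))
      else 0)"

definition D2 :: "(nat \<Rightarrow> real) \<Rightarrow> (nat \<Rightarrow> real) \<Rightarrow> nat \<Rightarrow> real" where
  "D2 t w n = (\<Sum>j=1..n. bdf2_kernel t n (n - j) * diff_quot t w j)"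

text \<open>
  \<open>divdiff t g n k\<close> is the \<open>k\<close>-th order Newton divided difference
  \<open>g[t n, t (n - 1), \<dots>, t (n - k)]\<close> of the data \<open>g i\<close> at the nodes \<open>t i\<close> (for \<open>k \<le> n\<close>).
\<close>

primrec divdiff :: "(nat \<Rightarrow> real) \<Rightarrow> (nat \<Rightarrow> real) \<Rightarrow> nat \<Rightarrow> nat \<Rightarrow> real" where
  "divdiff t g n 0 = g n"
| "divdiff t g n (Suc k) = (divdiff t g n k - divdiff t g (n - 1) k) / (t n - t (n - Suc k))"

definition D23 :: "(real \<Rightarrow> real \<Rightarrow> real) \<Rightarrow> (nat \<Rightarrow> real) \<Rightarrow> (nat \<Rightarrow> real) \<Rightarrow> nat \<Rightarrow> real" where
  "D23 f t w n =
     1 / 3 * (step_ratio t n * (step t n + step t (n - 1))\<^sup>2 - (1 + step_ratio t n) * (step t n)\<^sup>2)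
       * divdiff t (\<lambda>k. f (t k) (w k)) n 2"

definition D24 :: "(real \<Rightarrow> real \<Rightarrow> real) \<Rightarrow> (nat \<Rightarrow> real) \<Rightarrow> (nat \<Rightarrow> real) \<Rightarrow> nat \<Rightarrow> real" where
  "D24 f t w n =
     D23 f t w n
     + step t n / 12 * (step t n + step t (n - 1)) * (2 * step t n + step t (n - 1))
       * divdiff t (\<lambda>k. f (t k) (w k)) n 3"

lemma D23_alt:
  assumes "step t n > 0" "step t (n - 1) > 0"
  shows "D23 f t w n =
    step t n / 3 * (diff_quot t (\<lambda>k. f (t k) (w k)) n - diff_quot t (\<lambda>k. f (t k) (w k)) (n - 1))"
proof -
  define a where "a = step t n"
  define b where "b = step t (n - 1)"
  define g where "g = (\<lambda>k. f (t k) (w k))"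
  have pos: "a > 0" "b > 0" using assms by (auto simp: a_def b_def)
  have "n - Suc (Suc 0) = n - 1 - 1" by simp
  then have ab: "t n - t (n - Suc (Suc 0)) = a + b" by (simp add: a_def b_def step_def)
  have dd: "divdiff t g n 2 = (diff_quot t g n - diff_quot t g (n - 1)) / (a + b)"
    using ab by (simp add: numeral_2_eq_2 diff_quot_def step_def)
  have "1 / 3 * (a / b * (a + b)\<^sup>2 - (1 + a / b) * a\<^sup>2) = a / 3 * (a + b)"
    using pos by (simp add: field_simps power2_eq_square)
  then have "D23 f t w n = a / 3 * (a + b) * divdiff t g n 2"
    by (simp only: D23_def step_ratio_def flip: a_def b_def g_def)
  also have "\<dots> = a / 3 * (diff_quot t g n - diff_quot t g (n - 1))"
    using pos by (simp add: dd field_simps)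
  finally show ?thesis by (simp only: a_def g_def)
qed

text \<open>
  In the following scheme predicates the starting values (\<open>v 0\<close>, \<open>v 1\<close> for BDF2, and
  \<open>v 0\<close>, \<open>v 1\<close>, \<open>v 2\<close> for BDF2-DC4) are unconstrained.
\<close>

definition bdf2_solution ::
  "(real \<Rightarrow> real \<Rightarrow> real) \<Rightarrow> nat \<Rightarrow> (nat \<Rightarrow> real) \<Rightarrow> (nat \<Rightarrow> real) \<Rightarrow> bool" where
  "bdf2_solution f N t v2 \<longleftrightarrow> (\<forall>n\<in>{2..N}. D2 t v2 n = f (t n) (v2 n))"

definition bdf2_perturbed_solution ::
  "(real \<Rightarrow> real \<Rightarrow> real) \<Rightarrow> nat \<Rightarrow> (nat \<Rightarrow> real) \<Rightarrow> (nat \<Rightarrow> real) \<Rightarrow> (nat \<Rightarrow> real) \<Rightarrow> bool" where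
  "bdf2_perturbed_solution f N t \<epsilon>2 w2 \<longleftrightarrow>
     bounded (\<epsilon>2 ` {2..N}) \<and> (\<forall>n\<in>{2..N}. D2 t w2 n = f (t n) (w2 n) + \<epsilon>2 n)"

definition dc4_solution ::
  "(real \<Rightarrow> real \<Rightarrow> real) \<Rightarrow> nat \<Rightarrow> (nat \<Rightarrow> real) \<Rightarrow> (nat \<Rightarrow> real) \<Rightarrow> (nat \<Rightarrow> real) \<Rightarrow> bool" where
  "dc4_solution f N t v2 v4 \<longleftrightarrow> (\<forall>n\<in>{3..N}. D2 t v4 n + D24 f t v2 n = f (t n) (v4 n))"

definition dc4_perturbed_solution ::
  "(real \<Rightarrow> real \<Rightarrow> real) \<Rightarrow> nat \<Rightarrow> (nat \<Rightarrow> real) \<Rightarrow> (nat \<Rightarrow> real) \<Rightarrow> (nat \<Rightarrow> real) \<Rightarrow> (nat \<Rightarrow> real) \<Rightarrow> bool"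
  where
  "dc4_perturbed_solution f N t w2 \<epsilon>4 w4 \<longleftrightarrow>
     bounded (\<epsilon>4 ` {3..N}) \<and> (\<forall>n\<in>{3..N}. D2 t w4 n + D24 f t w2 n = f (t n) (w4 n) + \<epsilon>4 n)"

text \<open>
  The stability estimate at level \<open>n\<close> with prefactor \<open>C\<close>. The sequences \<open>v2\<close>, \<open>v4\<close> are the exact
  BDF2 and BDF2-DC4 solutions and \<open>w2\<close>, \<open>w4\<close> their perturbed counterparts.
\<close>

definition dc4_stability_estimate ::
  "real \<Rightarrow> (real \<Rightarrow> real \<Rightarrow> real) \<Rightarrow> nat \<Rightarrow> (nat \<Rightarrow> real) \<Rightarrow> (nat \<Rightarrow> real) \<Rightarrow> (nat \<Rightarrow> real)
    \<Rightarrow> (nat \<Rightarrow> real) \<Rightarrow> (nat \<Rightarrow> real) \<Rightarrow> (nat \<Rightarrow> real) \<Rightarrow> nat \<Rightarrow> bool" where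
  "dc4_stability_estimate C f N t v2 w2 v4 \<epsilon>4 w4 n \<longleftrightarrow>
     \<bar>w4 n - v4 n\<bar> \<le> C *
       (\<bar>w4 2 - v4 2\<bar> + max_step N t * \<bar>diff_quot t (\<lambda>k. w4 k - v4 k) 2\<bar>
        + t n * Max ((\<lambda>i. \<bar>\<epsilon>4 i\<bar> + \<bar>D24 f t v2 i - D24 f t w2 i\<bar>) ` {3..n}))"

text \<open>
  Mesh-robustness is the order of the quantifiers: one prefactor \<open>C\<close> serves all meshes of
  \<open>[0, T]\<close> with maximum step at most \<open>h\<close>, whatever their step ratios.
\<close>

definition dc4_mesh_robustly_stable :: "(real \<Rightarrow> real \<Rightarrow> real) \<Rightarrow> real \<Rightarrow> real \<Rightarrow> bool" where
  "dc4_mesh_robustly_stable f T h \<longleftrightarrow>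
     (\<exists>C. \<forall>N t v2 \<epsilon>2 w2 v4 \<epsilon>4 w4.
        is_mesh T N t \<and> max_step N t \<le> h
        \<and> bdf2_solution f N t v2 \<and> bdf2_perturbed_solution f N t \<epsilon>2 w2
        \<and> dc4_solution f N t v2 v4 \<and> dc4_perturbed_solution f N t w2 \<epsilon>4 w4
        \<longrightarrow> (\<forall>n\<in>{3..N}. dc4_stability_estimate C f N t v2 w2 v4 \<epsilon>4 w4 n))"

text \<open>
  Twice continuously differentiable on \<open>S\<close>, with derivatives relative to \<open>S\<close>. Intended for convex
  sets with nonempty interior, such as a closed strip, on which these derivatives are unique.
\<close>

definition C2_on :: "'a::real_normed_vector set \<Rightarrow> ('a \<Rightarrow> 'b::real_normed_vector) \<Rightarrow> bool" where
  "C2_on S g \<longleftrightarrow>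
     (\<exists>(g' :: 'a \<Rightarrow> 'a \<Rightarrow>\<^sub>L 'b) (g'' :: 'a \<Rightarrow> 'a \<Rightarrow>\<^sub>L ('a \<Rightarrow>\<^sub>L 'b)).
        (\<forall>x\<in>S. (g has_derivative blinfun_apply (g' x)) (at x within S)) \<and>
        (\<forall>x\<in>S. (g' has_derivative blinfun_apply (g'' x)) (at x within S)) \<and>
        continuous_on S g'')"

end

theory Submission
  imports Defs
begin

text \<open>
  Solving the BDF2 operator for the newest difference quotient expresses it as a convex combination
  of the previous one and of \<open>D2\<close>, in which the previous one has weight \<open>r / (1 + 2 * r) \<le> 1/2\<close>
  whatever the step ratio \<open>r\<close>. Hence the influence of the initial difference quotient decays
  geometrically, and the remainder is bounded by the running maximum of the Lipschitz term. Summing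
  the increments of the solution leaves a discrete Gronwall inequality for this running maximum.
\<close>

section \<open>The variable-step BDF2 operator\<close>

lemma D2_eq:
  assumes "2 \<le> n"
  shows "D2 t w n = (1 + 2 * step_ratio t n) / (1 + step_ratio t n) * diff_quot t w n
    - step_ratio t n / (1 + step_ratio t n) * diff_quot t w (n - 1)"
proof -
  \<comment> \<open>The kernel vanishes for lags of two or more, and \<open>2 \<le> n\<close> keeps
    both remaining indices inside \<open>{1..n}\<close>.\<close>
  have "D2 t w n = (\<Sum>j\<in>{n - 1, n}. bdf2_kernel t n (n - j) * diff_quot t w j)"
    unfolding D2_def using assms
    by (intro sum.mono_neutral_right) (auto simp: bdf2_kernel_def)
  also have "\<dots> = bdf2_kernel t n 1 * diff_quot t w (n - 1) + bdf2_kernel t n 0 * diff_quot t w n"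
    using assms by (subst sum.insert) auto
  finally show ?thesis
    by (simp add: bdf2_kernel_def)
qed

lemma D2_diff: "D2 t (\<lambda>k. u k - v k) n = D2 t u n - D2 t v n"
proof -
  have "diff_quot t (\<lambda>k. u k - v k) j = diff_quot t u j - diff_quot t v j" for j
    by (simp add: diff_quot_def flip: diff_divide_distrib)
  then show ?thesis by (simp add: D2_def right_diff_distrib sum_subtractf)
qed

text \<open>The bound 1/2 is the limit of \<open>r / (1 + 2 * r)\<close> as \<open>r\<close> grows.
  Exporting only the bound on \<alpha>, not its value, removes the step ratio from every later
  estimate.\<close>

lemma diff_quot_convex:
  assumes "2 \<le> n" "0 < step t n" "0 < step t (n - 1)"
  obtains \<alpha> where "0 \<le> \<alpha>" "\<alpha> \<le> 1 / 2"
    "diff_quot t w n = \<alpha> * diff_quot t w (n - 1) + (1 - \<alpha>) * D2 t w n"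
proof
  define r where "r = step_ratio t n"
  have r: "0 < r" using assms by (simp add: r_def step_ratio_def)
  show "0 \<le> r / (1 + 2 * r)" "r / (1 + 2 * r) \<le> 1 / 2"
    using r by (auto simp: field_simps)
  have weight: "1 - r / (1 + 2 * r) = (1 + r) / (1 + 2 * r)"
    using r by (simp add: field_simps)
  have "(1 + r) / (1 + 2 * r) * ((1 + 2 * r) / (1 + r) * x - r / (1 + r) * y)
      = x - r / (1 + 2 * r) * y" for x y
  proof -
    have "1 + r \<noteq> 0" "1 + 2 * r \<noteq> 0" using r by auto
    then show ?thesis by (simp add: right_diff_distrib)
  qed
  then show "diff_quot t w n
      = r / (1 + 2 * r) * diff_quot t w (n - 1) + (1 - r / (1 + 2 * r)) * D2 t w n"
    by (simp add: D2_eq[OF assms(1)] weight flip: r_def)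
qed

text \<open>The maximum starts at level 2, the last prescribed starting value. For
  \<open>k < 2\<close> the index set is empty and \<open>Max\<close> is unspecified, hence the
  assumptions \<open>2 \<le> k\<close> below.\<close>

definition running_max :: "(nat \<Rightarrow> real) \<Rightarrow> nat \<Rightarrow> real" where
  "running_max w k = Max ((\<lambda>j. \<bar>w j\<bar>) ` {2..k})"

lemma running_max_2: "running_max w 2 = \<bar>w 2\<bar>"
  by (simp add: running_max_def)

lemma running_max_Suc:
  assumes "2 \<le> k"
  shows "running_max w (Suc k) = max \<bar>w (Suc k)\<bar> (running_max w k)"
  using assms by (simp add: running_max_def atLeastAtMostSuc_conv)

lemma abs_le_running_max: "2 \<le> k \<Longrightarrow> \<bar>w k\<bar> \<le> running_max w k"
  by (simp add: running_max_def)

lemma running_max_nonneg: "2 \<le> k \<Longrightarrow> 0 \<le> running_max w k"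
  using abs_le_running_max[of k w] by linarith

section \<open>Discrete Gronwall argument\<close>

text \<open>Abstracts the error of a corrected scheme: \<open>M\<close> bounds all data terms up to
  level \<open>n\<close>. The inequality for \<open>D2\<close> starts at 3, so the difference
  quotient at level 2 enters as data.\<close>

locale bdf2_inequality =
  fixes t w :: "nat \<Rightarrow> real" and n :: nat and L M \<tau> :: real
  assumes step_pos: "\<And>k. k \<in> {1..n} \<Longrightarrow> 0 < step t k"
    and step_le: "\<And>k. k \<in> {1..n} \<Longrightarrow> step t k \<le> \<tau>"
    and t_0: "t 0 = 0"
    and L_nonneg: "0 \<le> L"
    and M_nonneg: "0 \<le> M"
    and L_step: "L * \<tau> \<le> 1 / 4"
    and D2_le: "\<And>k. k \<in> {3..n} \<Longrightarrow> \<bar>D2 t w k\<bar> \<le> L * \<bar>w k\<bar> + M"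
begin

lemma t_nonneg: "k \<le> n \<Longrightarrow> 0 \<le> t k"
proof (induction k)
  case (Suc k)
  then show ?case using step_pos[of "Suc k"] by (simp add: step_def)
qed (simp add: t_0)

text \<open>A convex combination preserves the bound \<open>L * running_max w k + M\<close>, while
  the excess over it is multiplied by \<alpha>, hence at least halved in each step.\<close>

lemma abs_diff_quot_le:
  assumes "2 \<le> k" "k \<le> n"
  shows "\<bar>diff_quot t w k\<bar> \<le> (1 / 2) ^ (k - 2) * \<bar>diff_quot t w 2\<bar> + L * running_max w k + M"
  using assms
proof (induction k rule: dec_induct)
  case base
  show ?case using L_nonneg M_nonneg running_max_nonneg[of 2 w] by simp
next
  case (step k)
  define q where "q = (1 / 2) ^ (k - 2) * \<bar>diff_quot t w 2\<bar>"
  \<comment> \<open>Taken at the new level, \<open>B\<close> dominates both the old bound, by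
    monotonicity, and \<open>D2\<close> at \<open>Suc k\<close>.\<close>
  define B where "B = L * running_max w (Suc k) + M"
  have q: "0 \<le> q" by (simp add: q_def)
  have mono: "L * running_max w k \<le> L * running_max w (Suc k)"
    using step.hyps L_nonneg by (simp add: running_max_Suc mult_left_mono)
  have prev: "\<bar>diff_quot t w k\<bar> \<le> q + B"
    using step mono by (simp add: q_def B_def)
  have "L * \<bar>w (Suc k)\<bar> \<le> L * running_max w (Suc k)"
    using step.hyps L_nonneg by (intro mult_left_mono abs_le_running_max) auto
  then have rhs: "\<bar>D2 t w (Suc k)\<bar> \<le> B"
    using D2_le[of "Suc k"] step by (simp add: B_def)
  obtain \<alpha> where \<alpha>: "0 \<le> \<alpha>" "\<alpha> \<le> 1 / 2"
    and eq: "diff_quot t w (Suc k) = \<alpha> * diff_quot t w k + (1 - \<alpha>) * D2 t w (Suc k)"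
    using diff_quot_convex[of "Suc k" t w] step_pos[of k] step_pos[of "Suc k"] step by auto
  have "\<bar>diff_quot t w (Suc k)\<bar> \<le> \<alpha> * \<bar>diff_quot t w k\<bar> + (1 - \<alpha>) * \<bar>D2 t w (Suc k)\<bar>"
    unfolding eq using \<alpha> by (intro order_trans[OF abs_triangle_ineq]) (simp add: abs_mult)
  also have "\<dots> \<le> \<alpha> * (q + B) + (1 - \<alpha>) * B"
    using \<alpha> prev rhs by (intro add_mono mult_left_mono) auto
  also have "\<dots> = \<alpha> * q + B" by (simp add: algebra_simps)
  also have "\<dots> \<le> 1 / 2 * q + B" using \<alpha> q by (intro add_mono mult_right_mono) auto
  also have "1 / 2 * q = (1 / 2) ^ (Suc k - 2) * \<bar>diff_quot t w 2\<bar>"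
    using step.hyps by (simp only: q_def Suc_diff_le power_Suc mult.assoc)
  finally show ?case by (simp add: B_def)
qed

text \<open>The factor \<open>1 - (1 / 2) ^ (k - 2)\<close> is the partial sum 1/2 + 1/4 + ... of
  the decaying contributions of the initial quotient. Keeping it exact lets the induction close with
  no further constant.\<close>

lemma running_max_le:
  assumes "2 \<le> k" "k \<le> n"
  shows "running_max w k \<le> exp (2 * L * t k) *
    (\<bar>w 2\<bar> + \<tau> * (1 - (1 / 2) ^ (k - 2)) * \<bar>diff_quot t w 2\<bar> + t k * M)"
  using assms
proof (induction k rule: dec_induct)
  case base
  have "1 * \<bar>w 2\<bar> \<le> exp (2 * L * t 2) * (\<bar>w 2\<bar> + t 2 * M)"
    using base t_nonneg[of 2] L_nonneg M_nonneg by (intro mult_mono) auto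
  then show ?case by (simp add: running_max_2)
next
  case (step k)
  define s where "s = step t (Suc k)"
  define d where "d = \<tau> * (1 / 2) ^ (Suc k - 2) * \<bar>diff_quot t w 2\<bar>"
  define B where
    "B m = \<bar>w 2\<bar> + \<tau> * (1 - (1 / 2) ^ (m - 2)) * \<bar>diff_quot t w 2\<bar> + t m * M" for m
  have s: "0 < s" "s \<le> \<tau>" using step_pos[of "Suc k"] step_le[of "Suc k"] step by (auto simp: s_def)
  have d: "0 \<le> d" using s by (simp add: d_def)
  have t_Suc: "t (Suc k) = t k + s" by (simp add: s_def step_def)
  have half: "(1 / 2 :: real) ^ (k - 2) = 2 * (1 / 2) ^ (Suc k - 2)"
    using step.hyps by (simp only: Suc_diff_le power_Suc)
  have B_Suc: "B (Suc k) = B k + d + s * M"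
    by (simp add: B_def d_def t_Suc half algebra_simps)
  have "w (Suc k) = w k + s * diff_quot t w (Suc k)"
    using s by (simp add: diff_quot_def s_def)
  then have "\<bar>w (Suc k)\<bar> \<le> \<bar>w k\<bar> + s * \<bar>diff_quot t w (Suc k)\<bar>"
    using s by (metis abs_mult abs_of_pos abs_triangle_ineq)
  also have "\<dots> \<le> running_max w k + s * ((1 / 2) ^ (Suc k - 2) * \<bar>diff_quot t w 2\<bar>
      + L * running_max w (Suc k) + M)"
    using step s abs_le_running_max[of k w] abs_diff_quot_le[of "Suc k"]
    by (intro add_mono mult_left_mono) auto
  also have "\<dots> = running_max w k + s * ((1 / 2) ^ (Suc k - 2) * \<bar>diff_quot t w 2\<bar>)
      + s * L * running_max w (Suc k) + s * M"
    by (simp add: algebra_simps)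
  \<comment> \<open>Replacing the step \<open>s\<close> by its bound \<tau> makes these
    contributions geometric; \<open>d\<close> is exactly the increment of that part of
    \<open>B\<close>.\<close>
  also have "s * ((1 / 2) ^ (Suc k - 2) * \<bar>diff_quot t w 2\<bar>) \<le> d"
    using s by (simp add: d_def mult.assoc mult_right_mono)
  finally have "\<bar>w (Suc k)\<bar> \<le> running_max w k + d + s * L * running_max w (Suc k) + s * M"
    by simp
  \<comment> \<open>With a nonnegative surplus the bound also covers the case that the maximum is
    still attained at an earlier level.\<close>
  moreover have "0 \<le> d + s * L * running_max w (Suc k) + s * M"
    using d s L_nonneg M_nonneg running_max_nonneg[of "Suc k" w] step.hyps by simp
  ultimately have "running_max w (Suc k)
      \<le> running_max w k + d + s * L * running_max w (Suc k) + s * M"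
    using step.hyps by (simp add: running_max_Suc)
  \<comment> \<open>The scheme is implicit, so the new maximum is on both sides; its share on the
    right is absorbed into the left.\<close>
  then have "(1 - s * L) * running_max w (Suc k) \<le> running_max w k + (d + s * M)"
    by (simp add: algebra_simps)
  also have "\<dots> \<le> exp (2 * L * t k) * B k + exp (2 * L * t k) * (d + s * M)"
  proof (rule add_mono)
    show "running_max w k \<le> exp (2 * L * t k) * B k"
      using step by (simp add: B_def)
    have "1 * (d + s * M) \<le> exp (2 * L * t k) * (d + s * M)"
      using step.prems d s M_nonneg L_nonneg t_nonneg[of k] by (intro mult_right_mono) auto
    then show "d + s * M \<le> exp (2 * L * t k) * (d + s * M)" by simp
  qed
  also have "\<dots> = exp (2 * L * t k) * B (Suc k)"
    by (simp add: B_Suc algebra_simps)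
  finally have main: "(1 - s * L) * running_max w (Suc k) \<le> exp (2 * L * t k) * B (Suc k)" .
  have x: "0 \<le> s * L" "s * L \<le> 1 / 4"
    using s L_nonneg L_step mult_right_mono[of s \<tau> L] by (auto simp: mult.commute)
  \<comment> \<open>Source of the rate \<open>2 * L\<close>: for x between 0 and 1/2, (1 + 2x)(1 -
    x) = 1 + x(1 - 2x) \<ge> 1, so 1/(1 - x) \<le> exp(2x).\<close>
  have "0 \<le> (s * L) * (1 - 2 * (s * L))" by (rule mult_nonneg_nonneg) (use x in simp_all)
  then have "1 \<le> (1 + 2 * (s * L)) * (1 - s * L)" by (simp add: algebra_simps)
  also have "\<dots> \<le> exp (2 * (s * L)) * (1 - s * L)"
    using x by (intro mult_right_mono exp_ge_add_one_self) auto
  finally have "running_max w (Suc k) \<le> exp (2 * (s * L)) * (1 - s * L) * running_max w (Suc k)"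
    using running_max_nonneg[of "Suc k" w] step.hyps by (simp add: mult_le_cancel_right1)
  also have "\<dots> \<le> exp (2 * (s * L)) * (exp (2 * L * t k) * B (Suc k))"
    using main by (simp add: mult.assoc)
  also have "\<dots> = exp (2 * L * t (Suc k)) * B (Suc k)"
    by (simp add: t_Suc distrib_left exp_add mult.commute mult.left_commute)
  finally show ?case by (simp add: B_def)
qed

text \<open>Moves the exponent from \<open>t n\<close> back to \<open>t (n - 1)\<close>: the last
  step adds at most 1 to it, and \<open>exp 1 \<le> 3\<close> is absorbed into the prefactor 4. The
  rate \<open>2 * L\<close> is relaxed to \<open>4 * L\<close>.\<close>

lemma abs_le:
  assumes "3 \<le> n"
  shows "\<bar>w n\<bar> \<le> 4 * exp (4 * L * t (n - 1)) * (\<bar>w 2\<bar> + \<tau> * \<bar>diff_quot t w 2\<bar> + t n * M)"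
proof -
  have \<tau>: "0 \<le> \<tau>" using step_pos[of n] step_le[of n] assms by auto
  have "2 * L * t n = 2 * (L * step t n) + 2 * L * t (n - 1)"
    by (simp add: step_def algebra_simps)
  also have "\<dots> \<le> 1 + 4 * L * t (n - 1)"
  proof (rule add_mono)
    show "2 * (L * step t n) \<le> 1"
      using mult_left_mono[OF step_le[of n] L_nonneg] L_step assms by auto
    show "2 * L * t (n - 1) \<le> 4 * L * t (n - 1)"
      using L_nonneg t_nonneg[of "n - 1"] by (intro mult_right_mono) auto
  qed
  finally have "exp (2 * L * t n) \<le> exp 1 * exp (4 * L * t (n - 1))"
    by (simp flip: exp_add)
  also have "\<dots> \<le> 4 * exp (4 * L * t (n - 1))"
    using exp_le by (intro mult_right_mono) auto
  finally have factor: "exp (2 * L * t n) \<le> 4 * exp (4 * L * t (n - 1))" .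
  have "\<bar>w n\<bar> \<le> running_max w n" using assms by (simp add: abs_le_running_max)
  also have "\<dots> \<le> exp (2 * L * t n) *
      (\<bar>w 2\<bar> + \<tau> * (1 - (1 / 2) ^ (n - 2)) * \<bar>diff_quot t w 2\<bar> + t n * M)"
    using assms by (intro running_max_le) auto
  also have "\<dots> \<le> exp (2 * L * t n) * (\<bar>w 2\<bar> + \<tau> * \<bar>diff_quot t w 2\<bar> + t n * M)"
  proof -
    have "\<tau> * (1 - (1 / 2) ^ (n - 2)) \<le> \<tau> * 1" using \<tau> by (intro mult_left_mono) auto
    then show ?thesis
      using t_nonneg[of n] by (intro mult_left_mono add_mono mult_right_mono) auto
  qed
  also have "\<dots> \<le> 4 * exp (4 * L * t (n - 1)) * (\<bar>w 2\<bar> + \<tau> * \<bar>diff_quot t w 2\<bar> + t n * M)"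
    using \<tau> M_nonneg t_nonneg[of n]
    by (intro mult_right_mono factor add_nonneg_nonneg mult_nonneg_nonneg) auto
  finally show ?thesis .
qed

end

section \<open>Elementary mesh facts\<close>

lemma mesh_step_pos:
  assumes "is_mesh T N t" "k \<in> {1..N}"
  shows "0 < step t k"
  using assms by (cases k) (auto simp: is_mesh_def step_def)

lemma mesh_mono:
  assumes "is_mesh T N t" "i \<le> j" "j \<le> N"
  shows "t i \<le> t j"
  using assms(2,3)
proof (induction j rule: dec_induct)
  case (step j)
  moreover have "t j < t (Suc j)" using assms(1) step.prems by (simp add: is_mesh_def)
  ultimately show ?case by simp
qed simp

lemma mesh_range:
  assumes "is_mesh T N t" "k \<le> N"
  shows "t k \<in> {0..T}"
  using mesh_mono[OF assms(1), of 0 k] mesh_mono[OF assms(1), of k N] assms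
  by (auto simp: is_mesh_def)

lemma step_le_max_step: "k \<in> {1..N} \<Longrightarrow> step t k \<le> max_step N t"
  by (simp add: max_step_def)

section \<open>Error of the BDF2-DC4 scheme\<close>

lemma dc4_error_equation:
  assumes "dc4_solution f N t v2 v4" "dc4_perturbed_solution f N t w2 \<epsilon>4 w4" "k \<in> {3..N}"
  shows "D2 t (\<lambda>k. w4 k - v4 k) k
    = f (t k) (w4 k) - f (t k) (v4 k) + D24 f t v2 k - D24 f t w2 k + \<epsilon>4 k"
proof -
  have "D2 t v4 k + D24 f t v2 k = f (t k) (v4 k)"
    "D2 t w4 k + D24 f t w2 k = f (t k) (w4 k) + \<epsilon>4 k"
    using assms by (auto simp: dc4_solution_def dc4_perturbed_solution_def)
  then show ?thesis by (simp add: D2_diff)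
qed

text \<open>The differences of the corrections are treated as data alongside the perturbations; only
  the difference of \<open>f\<close> at \<open>w4\<close> and \<open>v4\<close> is estimated by the
  Lipschitz condition.\<close>

lemma dc4_stability:
  assumes mesh: "is_mesh T N t" and max_step: "max_step N t \<le> 1 / (4 * L)"
    and L: "0 < L" and lip: "\<forall>s\<in>{0..T}. L-lipschitz_on UNIV (f s)"
    and sol: "dc4_solution f N t v2 v4" "dc4_perturbed_solution f N t w2 \<epsilon>4 w4"
    and n: "n \<in> {3..N}"
  shows "dc4_stability_estimate (4 * exp (4 * L * t (n - 1))) f N t v2 w2 v4 \<epsilon>4 w4 n"
proof -
  define F where "F i = \<bar>\<epsilon>4 i\<bar> + \<bar>D24 f t v2 i - D24 f t w2 i\<bar>" for i
  define M where "M = Max (F ` {3..n})"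
  have F_le: "F k \<le> M" if "k \<in> {3..n}" for k
    using that by (simp add: M_def)
  \<comment> \<open>The locale is instantiated at level \<open>n\<close> rather than
    \<open>N\<close>, so that \<open>M\<close> is the maximum over \<open>{3..n}\<close>
    only.\<close>
  interpret bdf2_inequality t "\<lambda>k. w4 k - v4 k" n L M "max_step N t"
  proof
    fix k assume "k \<in> {1..n}"
    with n have k: "k \<in> {1..N}" by auto
    show "0 < step t k" using mesh_step_pos[OF mesh k] .
    show "step t k \<le> max_step N t" using step_le_max_step[OF k] .
  next
    show "t 0 = 0" using mesh by (simp add: is_mesh_def)
    show "0 \<le> L" using L by simp
    have "0 \<le> F n" by (simp add: F_def)
    with F_le[of n] n show "0 \<le> M" by auto
    show "L * max_step N t \<le> 1 / 4"
      using max_step L by (simp add: field_simps)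
  next
    fix k assume k: "k \<in> {3..n}"
    have "\<bar>f (t k) (w4 k) - f (t k) (v4 k)\<bar> \<le> L * \<bar>w4 k - v4 k\<bar>"
      using lip mesh_range[OF mesh, of k] k n lipschitz_onD[of L UNIV "f (t k)" "w4 k" "v4 k"]
      by (auto simp: dist_real_def)
    then show "\<bar>D2 t (\<lambda>k. w4 k - v4 k) k\<bar> \<le> L * \<bar>w4 k - v4 k\<bar> + M"
      using F_le[OF k] dc4_error_equation[OF sol, of k] k n by (auto simp: F_def)
  qed
  show ?thesis
    using abs_le n by (simp add: dc4_stability_estimate_def M_def F_def[abs_def])
qed

text \<open>The prefactor may be enlarged because the bracket it multiplies is nonnegative on a
  mesh.\<close>

lemma dc4_stability_estimate_mono:
  assumes "dc4_stability_estimate C f N t v2 w2 v4 \<epsilon>4 w4 n" "C \<le> C'"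
    and mesh: "is_mesh T N t" and n: "n \<in> {3..N}"
  shows "dc4_stability_estimate C' f N t v2 w2 v4 \<epsilon>4 w4 n"
proof -
  define F where "F i = \<bar>\<epsilon>4 i\<bar> + \<bar>D24 f t v2 i - D24 f t w2 i\<bar>" for i
  have "0 \<le> F n" by (simp add: F_def)
  also have "F n \<le> Max (F ` {3..n})" using n by simp
  finally have M: "0 \<le> Max (F ` {3..n})" .
  have "0 \<le> max_step N t"
    using mesh_step_pos[OF mesh, of n] step_le_max_step[of n N t] n by auto
  moreover have "0 \<le> t n" using mesh_range[OF mesh, of n] n by auto
  ultimately have
    "0 \<le> \<bar>w4 2 - v4 2\<bar> + max_step N t * \<bar>diff_quot t (\<lambda>k. w4 k - v4 k) 2\<bar> + t n * Max (F ` {3..n})"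
    using M by (intro add_nonneg_nonneg mult_nonneg_nonneg) auto
  from mult_right_mono[OF assms(2) this] show ?thesis
    using assms(1) unfolding dc4_stability_estimate_def F_def by linarith
qed

theorem theorem4p1:
  fixes f :: "real \<Rightarrow> real \<Rightarrow> real" and T L :: real
  assumes T_pos: "0 < T"
    and L_pos: "0 < L"
    and f_lipschitz: "\<forall>s\<in>{0..T}. L-lipschitz_on UNIV (f s)"
    and f_C2: "C2_on ({0..T} \<times> UNIV) (\<lambda>(s, x). f s x)"
  shows
    "(\<forall>N t v2 \<epsilon>2 w2 v4 \<epsilon>4 w4.
        is_mesh T N t \<and> max_step N t \<le> 1 / (4 * L)
        \<and> bdf2_solution f N t v2 \<and> bdf2_perturbed_solution f N t \<epsilon>2 w2
        \<and> dc4_solution f N t v2 v4 \<and> dc4_perturbed_solution f N t w2 \<epsilon>4 w4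
        \<longrightarrow> (\<forall>n\<in>{3..N}.
              D2 t (\<lambda>k. w4 k - v4 k) n
                = f (t n) (w4 n) - f (t n) (v4 n) + D24 f t v2 n - D24 f t w2 n + \<epsilon>4 n
              \<and> dc4_stability_estimate (4 * exp (4 * L * t (n - 1))) f N t v2 w2 v4 \<epsilon>4 w4 n))
     \<and> dc4_mesh_robustly_stable f T (1 / (4 * L))"
proof (intro conjI allI impI ballI)
  fix N t v2 \<epsilon>2 w2 v4 \<epsilon>4 w4 n
  assume "is_mesh T N t \<and> max_step N t \<le> 1 / (4 * L)
      \<and> bdf2_solution f N t v2 \<and> bdf2_perturbed_solution f N t \<epsilon>2 w2
      \<and> dc4_solution f N t v2 v4 \<and> dc4_perturbed_solution f N t w2 \<epsilon>4 w4"
    and n: "n \<in> {3..N}"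
  then show "D2 t (\<lambda>k. w4 k - v4 k) n
        = f (t n) (w4 n) - f (t n) (v4 n) + D24 f t v2 n - D24 f t w2 n + \<epsilon>4 n"
    and "dc4_stability_estimate (4 * exp (4 * L * t (n - 1))) f N t v2 w2 v4 \<epsilon>4 w4 n"
    using dc4_error_equation dc4_stability[OF _ _ L_pos f_lipschitz] by blast+
next
  show "dc4_mesh_robustly_stable f T (1 / (4 * L))"
    unfolding dc4_mesh_robustly_stable_def
  \<comment> \<open>Since \<open>t (n - 1) \<le> T\<close>, this witness dominates every prefactor
    obtained above, and it is fixed before the mesh is chosen.\<close>
  proof (intro exI[of _ "4 * exp (4 * L * T)"] allI impI ballI, elim conjE)
    fix N t v2 \<epsilon>2 w2 v4 \<epsilon>4 w4 n
    assume mesh: "is_mesh T N t" and n: "n \<in> {3..N}"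
      and rest: "max_step N t \<le> 1 / (4 * L)" "dc4_solution f N t v2 v4"
        "dc4_perturbed_solution f N t w2 \<epsilon>4 w4"
    have "4 * exp (4 * L * t (n - 1)) \<le> 4 * exp (4 * L * T)"
      using mesh_range[OF mesh, of "n - 1"] n L_pos by auto
    with dc4_stability[OF mesh rest(1) L_pos f_lipschitz rest(2,3) n]
    show "dc4_stability_estimate (4 * exp (4 * L * T)) f N t v2 w2 v4 \<epsilon>4 w4 n"
      by (rule dc4_stability_estimate_mono[OF _ _ mesh n])
  qed
qed

end
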